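(* Let $$0<\lambda_1<\lambda_2<\cdots<\lambda_{n-1},\qquad b_1,\dots,b_{n-1}<0,\qquad M>0$$ be the spectral data of a discrete cubic string $\{m_k,x_k\}_{k=1}^n$ with $m_k>0$ and $x_1<\cdots<x_n$. Then the string data can be recovered uniquely from the spectral data, up to a translation along the $x$ axis, from the determinantal formulas $$m_{n-k}=\frac{\mathcal{D}_k^2}{2\,\mathcal{A}_{k+1}\mathcal{A}_k}\quad(0\le k\le n-1),\qquad l_{n-k}=-\frac{2\,\mathcal{A}_k}{\mathcal{D}'_k}\quad(1\le k\le n-1),$$ where $l_j=x_{j+1}-x_j$.
   Context: Spectral data of a string. Given $x_1<\cdots<x_n$ and $m_1,\dots,m_n>0$, put $l_k=x_{k+1}-x_k$, $$L_k=\begin{pmatrix}1&l_k&l_k^2/2\\0&1&l_k\\0&0&1\end{pmatrix},\qquad G_k(z)=\begin{pmatrix}1&0&0\\0&1&0\\-2m_kz&0&1\end{pmatrix},$$ and define polynomials by $(C(z),B(z),A(z))^t=G_n(z)L_{n-1}G_{n-1}(z)\cdots L_1G_1(z)(1,0,0)^t$. (This is the vector $(\phi,\phi_x,\phi_{xx})^t$ at $x_n^+$, where $-\phi'''=zm\phi$ with $m(x)=2\sum_k m_k\delta(x-x_k)$ and $\phi=1$ for $x<x_1$.) The zeros of $A$ are simple, namely $0$ and $0<\lambda_1<\cdots<\lambda_{n-1}$, and $B(0)=0$. The numbers $b_k$ are the residues in $\frac{B(z)}{A(z)}=\sum_{k=1}^{n-1}\frac{b_k}{z-\lambda_k}$,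 and $M=\sum_{k=1}^n m_k$. The spectral data are $\{\lambda_k,b_k\}_{k=1}^{n-1}$ together with $M$. Determinants. With $d\mu(\lambda)=\sum_{k=1}^{n-1}b_k\,\delta(\lambda-\lambda_k)$ put $$\beta_j=\int\lambda^j\,d\mu(\lambda)=\sum_{k=1}^{n-1}b_k\lambda_k^j,\qquad I_{ij}=\iint\frac{\kappa^i\lambda^j}{\kappa+\lambda}\,d\mu(\kappa)d\mu(\lambda)=\sum_{p,q=1}^{n-1}\frac{\lambda_p^i\lambda_q^j}{\lambda_p+\lambda_q}b_pb_q .$$ Set $\mathcal{A}_0=\mathcal{D}_0=1$. For $k\ge1$: $\mathcal{A}_k$ is the $k\times k$ determinant of the matrix $(I_{ij})_{0\le i,j\le k-1}$ with its $(0,0)$ entry replaced by $I_{00}+\frac1{2M}$; $\mathcal{D}_k=\det(I_{ij})_{1\le i\le k,\;0\le j\le k-1}$; and $\mathcal{D}'_k$ is the $k\times k$ determinant whose first column is $(\beta_0,\beta_1,\dots,\beta_{k-1})^t$ and whose remaining columns are $(I_{1j},I_{2j},\dots,I_{kj})^t$ for $j=0,\dots,k-2$ (so $\mathcal{D}'_1=\beta_0$). *)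

theory Defs
  imports Complex_Main "Jordan_Normal_Form.Determinant"
begin

text \<open>
  A discrete cubic string with \<open>n\<close> masses is given by positions \<open>x 1 < \<dots> < x n\<close> and masses
  \<open>m 1, \<dots>, m n > 0\<close>. Sequences are functions on the naturals; only the values at the stated
  indices are relevant.
\<close>

definition discrete_string :: "nat \<Rightarrow> (nat \<Rightarrow> real) \<Rightarrow> (nat \<Rightarrow> real) \<Rightarrow> bool" where
  "discrete_string n m x \<longleftrightarrow> strict_mono_on {1..n} x \<and> (\<forall>k\<in>{1..n}. m k > 0)"

definition L_mat :: "real \<Rightarrow> complex poly mat" where
  "L_mat l = mat_of_rows_list 3
     [[1, [:of_real l:], [:of_real (l\<^sup>2 / 2):]],
      [0, 1,             [:of_real l:]],
      [0, 0,             1]]"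

text \<open>The polynomial \<open>[:0, - 2 m:]\<close> is \<open>- 2 m z\<close>.\<close>

definition G_mat :: "real \<Rightarrow> complex poly mat" where
  "G_mat m = mat_of_rows_list 3
     [[1,                      0, 0],
      [0,                      1, 0],
      [[:0, of_real (- 2 * m):], 0, 1]]"

text \<open>
  For \<open>k \<ge> 1\<close>, \<open>phi_vec m x k\<close> is \<open>G\<^sub>k L\<^bsub>k-1\<^esub> G\<^bsub>k-1\<^esub> \<dots> L\<^sub>1 G\<^sub>1 (1,0,0)\<^sup>t\<close>,
  that is, the vector of \<open>\<phi>\<close> and its first two derivatives immediately to the right of \<open>x k\<close>.
\<close>

fun phi_vec :: "(nat \<Rightarrow> real) \<Rightarrow> (nat \<Rightarrow> real) \<Rightarrow> nat \<Rightarrow> complex poly vec" where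
  "phi_vec m x 0 = vec_of_list [1, 0, 0]"
| "phi_vec m x (Suc 0) = G_mat (m 1) *\<^sub>v phi_vec m x 0"
| "phi_vec m x (Suc (Suc k)) =
     G_mat (m (k + 2)) *\<^sub>v (L_mat (x (k + 2) - x (k + 1)) *\<^sub>v phi_vec m x (Suc k))"

definition B_poly :: "nat \<Rightarrow> (nat \<Rightarrow> real) \<Rightarrow> (nat \<Rightarrow> real) \<Rightarrow> complex poly" where
  "B_poly n m x = phi_vec m x n $ 1"

definition A_poly :: "nat \<Rightarrow> (nat \<Rightarrow> real) \<Rightarrow> (nat \<Rightarrow> real) \<Rightarrow> complex poly" where
  "A_poly n m x = phi_vec m x n $ 2"

text \<open>
  The zeros of \<open>A\<close> are simple, namely \<open>0\<close> and \<open>0 < lam 1 < \<dots> < lam (n-1)\<close>; the \<open>b k\<close> are the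
  residues in the partial fraction expansion of \<open>B / A\<close>; and \<open>M\<close> is the total mass.
\<close>

definition spectral_data ::
  "nat \<Rightarrow> (nat \<Rightarrow> real) \<Rightarrow> (nat \<Rightarrow> real) \<Rightarrow> (nat \<Rightarrow> real) \<Rightarrow> (nat \<Rightarrow> real) \<Rightarrow> real \<Rightarrow> bool" where
  "spectral_data n m x lam b M \<longleftrightarrow>
     strict_mono_on {1..n-1} lam \<and>
     (\<forall>k\<in>{1..n-1}. 0 < lam k) \<and>
     {z. poly (A_poly n m x) z = 0} = of_real ` insert 0 (lam ` {1..n-1}) \<and>
     (\<forall>z. poly (A_poly n m x) z = 0 \<longrightarrow> order z (A_poly n m x) = 1) \<and>
     (\<forall>z. poly (A_poly n m x) z \<noteq> 0 \<longrightarrow>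
        poly (B_poly n m x) z / poly (A_poly n m x) z =
          (\<Sum>k=1..n-1. of_real (b k) / (z - of_real (lam k)))) \<and>
     M = (\<Sum>k=1..n. m k)"

text \<open>In the following, \<open>N = n - 1\<close> is the number of atoms of the measure \<open>\<mu>\<close>.\<close>

definition moment :: "nat \<Rightarrow> (nat \<Rightarrow> real) \<Rightarrow> (nat \<Rightarrow> real) \<Rightarrow> nat \<Rightarrow> real" where
  "moment N lam b j = (\<Sum>k=1..N. b k * lam k ^ j)"

definition bimoment :: "nat \<Rightarrow> (nat \<Rightarrow> real) \<Rightarrow> (nat \<Rightarrow> real) \<Rightarrow> nat \<Rightarrow> nat \<Rightarrow> real" where
  "bimoment N lam b i j =
     (\<Sum>p=1..N. \<Sum>q=1..N. lam p ^ i * lam q ^ j / (lam p + lam q) * b p * b q)"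

text \<open>
  Matrix indices start at 0. The determinant of the empty matrix is 1, which gives the
  conventions for \<open>k = 0\<close>.
\<close>

definition A_det :: "nat \<Rightarrow> (nat \<Rightarrow> real) \<Rightarrow> (nat \<Rightarrow> real) \<Rightarrow> real \<Rightarrow> nat \<Rightarrow> real" where
  "A_det N lam b M k = det (mat k k (\<lambda>(i, j).
     if i = 0 \<and> j = 0 then bimoment N lam b 0 0 + 1 / (2 * M) else bimoment N lam b i j))"

definition D_det :: "nat \<Rightarrow> (nat \<Rightarrow> real) \<Rightarrow> (nat \<Rightarrow> real) \<Rightarrow> nat \<Rightarrow> real" where
  "D_det N lam b k = det (mat k k (\<lambda>(i, j). bimoment N lam b (i + 1) j))"

definition D'_det :: "nat \<Rightarrow> (nat \<Rightarrow> real) \<Rightarrow> (nat \<Rightarrow> real) \<Rightarrow> nat \<Rightarrow> real" where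
  "D'_det N lam b k = det (mat k k (\<lambda>(i, j).
     if j = 0 then moment N lam b i else bimoment N lam b (i + 1) (j - 1)))"

end

theory Submission
  imports Defs
begin

text \<open>
  Let \<open>U = (C, B, A)\<close> be the vector at the last mass and \<open>u\<close> the vector \<open>k\<close> masses earlier, so that
  \<open>U = S u\<close> for a product \<open>S\<close> of \<open>k\<close> factors \<open>G L\<close>. Both \<open>G\<close> and \<open>L\<close> preserve the pairing of
  \<open>v(z)\<close> and \<open>w(-z)\<close> by \<open>v\<^sub>1 w\<^sub>3 - v\<^sub>2 w\<^sub>2 + v\<^sub>3 w\<^sub>1\<close>, so \<open>U\<close> is isotropic and \<open>u\<close> is obtained by pairing
  \<open>U\<close> with the columns of \<open>S\<close>. Since the second order minors of \<open>S\<close> have degree at most \<open>k\<close>, the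
  columns of \<open>S\<close> are approximations to \<open>B / A\<close> at infinity. Summing the residues of
  \<open>z\<^sup>i u / A\<close> shows that \<open>q = S\<^sub>3\<^sub>3\<close> is orthogonal to all powers below \<open>k\<close> with respect to the bimoment
  form with the correction \<open>1 / (2 M)\<close>, with \<open>q(0) = 1\<close> and \<open>\<langle>z\<^sup>k, q\<rangle> = 1 / (2 m c)\<close>, where \<open>m\<close> is the
  mass at the position of \<open>u\<close> and \<open>c\<close> the leading coefficient of \<open>q\<close>. Likewise \<open>S\<^sub>3\<^sub>2 / z\<close> solves the linear system behind
  \<open>D'_det\<close>, and its leading coefficient is \<open>2 c / l\<close>. Cramer's rule gives the formulas; they
  determine the string up to translation.
\<close>

section \<open>Interpolation and linear systems\<close>

text \<open>Both sides have degree below \<open>card I\<close> and agree at the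
  \<open>card I\<close> distinct nodes.\<close>

lemma poly_eq_lagrange:
  fixes f :: "'a :: field poly" and x :: "'i \<Rightarrow> 'a"
  assumes "finite I" "inj_on x I" "degree f < card I"
  shows "f = (\<Sum>p\<in>I. smult (poly f (x p) / (\<Prod>q\<in>I-{p}. x p - x q)) (\<Prod>q\<in>I-{p}. [:- x q, 1:]))"
    (is "f = ?g")
proof (rule poly_eqI_degree[of "x ` I"])
  have card: "card (x ` I) = card I"
    using assms(2) by (rule card_image)
  show "degree f < card (x ` I)"
    using assms(3) card by simp
  have "degree ?g \<le> card I - 1"
  proof (rule degree_sum_le[OF assms(1)])
    fix p assume p: "p \<in> I"
    have "degree (\<Prod>q\<in>I-{p}. [:- x q, 1:]) = (\<Sum>q\<in>I-{p}. degree [:- x q, 1:])"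
      by (rule degree_prod_eq_sum_degree) auto
    also have "\<dots> = card I - 1"
      using p assms(1) by (simp add: card_Diff_singleton)
    finally show "degree (smult (poly f (x p) / (\<Prod>q\<in>I-{p}. x p - x q)) (\<Prod>q\<in>I-{p}. [:- x q, 1:])) \<le> card I - 1"
      by (metis degree_smult_le)
  qed
  then show "degree ?g < card (x ` I)"
    using assms(3) card by linarith
  fix y assume "y \<in> x ` I"
  then obtain r where r: "r \<in> I" "y = x r" by blast
  have "poly ?g (x r) = (\<Sum>p\<in>I. if p = r then poly f (x r) else 0)"
    unfolding poly_sum
  proof (rule sum.cong[OF refl])
    fix p assume p: "p \<in> I"
    show "poly (smult (poly f (x p) / (\<Prod>q\<in>I-{p}. x p - x q)) (\<Prod>q\<in>I-{p}. [:- x q, 1:])) (x r) =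
      (if p = r then poly f (x r) else 0)"
    proof (cases "p = r")
      case True
      have "(\<Prod>q\<in>I-{r}. x r - x q) \<noteq> 0"
        using assms(1,2) r by (auto simp: prod_zero_iff inj_on_def)
      then show ?thesis
        using True by (simp add: poly_prod)
    next
      case False
      then have "(\<Prod>q\<in>I-{p}. x r - x q) = 0"
        using assms(1) r by (intro prod_zero) auto
      then show ?thesis
        using False by (simp add: poly_prod)
    qed
  qed
  also have "\<dots> = poly f (x r)"
    using r assms(1) by simp
  finally show "poly f y = poly ?g y"
    using r by simp
qed

text \<open>Every basis product is monic of degree \<open>card I - 1\<close>, so the top
  coefficients of the interpolation formula can be compared. This is the algebraic residue theorem
  behind \<open>residue_sum\<close>.\<close>

lemma coeff_lagrange:
  fixes f :: "'a :: field poly" and x :: "'i \<Rightarrow> 'a"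
  assumes "finite I" "inj_on x I" "degree f < card I"
  shows "coeff f (card I - 1) = (\<Sum>p\<in>I. poly f (x p) / (\<Prod>q\<in>I-{p}. x p - x q))"
proof -
  have "coeff (\<Prod>q\<in>I-{p}. [:- x q, 1:]) (card I - 1) = 1" if "p \<in> I" for p
  proof -
    have "degree (\<Prod>q\<in>I-{p}. [:- x q, 1:]) = (\<Sum>q\<in>I-{p}. degree [:- x q, 1:])"
      by (rule degree_prod_eq_sum_degree) auto
    also have "\<dots> = card I - 1"
      using that assms(1) by (simp add: card_Diff_singleton)
    finally show ?thesis
      using lead_coeff_prod[of "\<lambda>q. [:- x q, 1:]" "I - {p}"] by simp
  qed
  then show ?thesis
    by (subst poly_eq_lagrange[OF assms]) (simp add: coeff_sum)
qed

lemma coeff_mult_top: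
  fixes p q :: "'a :: comm_ring_1 poly"
  assumes "degree p \<le> d" "degree q \<le> e"
  shows "coeff (p * q) (d + e) = coeff p d * coeff q e"
proof -
  have "coeff (p * q) (d + e) = (\<Sum>i\<le>d + e. if i = d then coeff p d * coeff q e else 0)"
    unfolding coeff_mult
  proof (rule sum.cong[OF refl])
    fix i
    consider "i < d" | "i = d" | "i > d" by linarith
    then show "coeff p i * coeff q (d + e - i) = (if i = d then coeff p d * coeff q e else 0)"
      using assms by cases (auto simp: coeff_eq_0)
  qed
  then show ?thesis by simp
qed

text \<open>Expanding along the replaced column leaves a single cofactor. The first unknown leads to
  \<open>D_det\<close>, the last one to the next smaller \<open>A_det\<close>.\<close>

lemma cramer_last_unit_vector:
  fixes g :: "nat \<Rightarrow> nat \<Rightarrow> 'a :: field"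
  assumes eq: "\<And>i. i \<le> k \<Longrightarrow> (\<Sum>j\<le>k. g i j * c j) = (if i = k then h else 0)"
  shows "c 0 * det (mat (Suc k) (Suc k) (\<lambda>(i, j). g i j)) =
           h * (-1) ^ k * det (mat k k (\<lambda>(i, j). g i (Suc j)))"
    and "c k * det (mat (Suc k) (Suc k) (\<lambda>(i, j). g i j)) = h * det (mat k k (\<lambda>(i, j). g i j))"
proof -
  let ?A = "mat (Suc k) (Suc k) (\<lambda>(i, j). g i j)"
  let ?c = "vec (Suc k) c"
  have Ac: "?A *\<^sub>v ?c = vec (Suc k) (\<lambda>i. if i = k then h else 0)"
    using eq by (intro eq_vecI)
      (auto simp: scalar_prod_def atLeast0LessThan lessThan_Suc_atMost less_Suc_eq_le)
  have *: "c r * det ?A = h * cofactor (replace_col ?A (?A *\<^sub>v ?c) r) k r" if "r \<le> k" for r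
  proof -
    let ?B = "replace_col ?A (?A *\<^sub>v ?c) r"
    have "c r * det ?A = det ?B"
      using cramer_lemma_mat[of ?A "Suc k" ?c r] that by simp
    also have "\<dots> = (\<Sum>i<Suc k. ?B $$ (i, r) * cofactor ?B i r)"
      by (rule laplace_expansion_column) (use that in \<open>auto simp: replace_col_def\<close>)
    also have "\<dots> = (\<Sum>i<Suc k. if i = k then h * cofactor ?B k r else 0)"
      by (rule sum.cong[OF refl]) (use that in \<open>auto simp: Ac\<close>, auto simp: replace_col_def)
    finally show ?thesis by simp
  qed
  have "mat_delete (replace_col ?A v 0) k 0 = mat k k (\<lambda>(i, j). g i (Suc j))" for v
    by (rule eq_matI) (auto simp: mat_delete_def replace_col_def)
  then show "c 0 * det ?A = h * (-1) ^ k * det (mat k k (\<lambda>(i, j). g i (Suc j)))"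
    using *[of 0] by (simp add: cofactor_def)
  have "mat_delete (replace_col ?A v k) k k = mat k k (\<lambda>(i, j). g i j)" for v
    by (rule eq_matI) (auto simp: mat_delete_def replace_col_def)
  then show "c k * det ?A = h * det (mat k k (\<lambda>(i, j). g i j))"
    using *[of k] by (simp add: cofactor_def)
qed

text \<open>Cramer's rule puts \<open>v\<close> into the last column, whereas \<open>D'_det\<close>
  has it in the first. The minors along \<open>v\<close> are the same, and the signs of the
  cofactors differ by \<open>(-1) ^ k\<close>.\<close>

lemma cramer_last_component:
  fixes g :: "nat \<Rightarrow> nat \<Rightarrow> 'a :: field"
  assumes eq: "\<And>i. i \<le> k \<Longrightarrow> (\<Sum>j\<le>k. g i j * c j) = v i"
  shows "c k * det (mat (Suc k) (Suc k) (\<lambda>(i, j). g i j)) =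
           (-1) ^ k * det (mat (Suc k) (Suc k) (\<lambda>(i, j). if j = 0 then v i else g i (j - 1)))"
    (is "_ = _ * det ?D")
proof -
  let ?A = "mat (Suc k) (Suc k) (\<lambda>(i, j). g i j)"
  let ?c = "vec (Suc k) c"
  let ?B = "replace_col ?A (?A *\<^sub>v ?c) k"
  have Ac: "?A *\<^sub>v ?c = vec (Suc k) v"
    using eq by (intro eq_vecI)
      (auto simp: scalar_prod_def atLeast0LessThan lessThan_Suc_atMost less_Suc_eq_le)
  have B: "?B $$ (i, k) = v i" if "i < Suc k" for i
    using that unfolding Ac by (simp add: replace_col_def)
  have del: "mat_delete ?B i k = mat_delete ?D i 0" if "i < Suc k" for i
    using that by (intro eq_matI) (auto simp: mat_delete_def replace_col_def)
  have "c k * det ?A = det ?B"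
    using cramer_lemma_mat[of ?A "Suc k" ?c k] by simp
  also have "\<dots> = (\<Sum>i<Suc k. ?B $$ (i, k) * cofactor ?B i k)"
    by (rule laplace_expansion_column) (auto simp: replace_col_def)
  also have "\<dots> = (\<Sum>i<Suc k. (-1) ^ k * (?D $$ (i, 0) * cofactor ?D i 0))"
    by (rule sum.cong[OF refl], simp only: B del cofactor_def lessThan_iff) (simp add: power_add)
  also have "\<dots> = (-1) ^ k * (\<Sum>i<Suc k. ?D $$ (i, 0) * cofactor ?D i 0)"
    by (rule sum_distrib_left[symmetric])
  also have "(\<Sum>i<Suc k. ?D $$ (i, 0) * cofactor ?D i 0) = det ?D"
    by (rule laplace_expansion_column[symmetric]) auto
  finally show ?thesis .
qed

section \<open>Transfer matrices\<close>

lemma poly_eqI_poly: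
  fixes p q :: "real poly"
  assumes "\<And>z. poly p z = poly q z"
  shows "p = q"
  using assms by (simp add: poly_eq_poly_eq_iff[symmetric] fun_eq_iff)

text \<open>
  Real version of \<open>phi_vec\<close> with indices shifted to start at 0: mass \<open>m j\<close>, and length \<open>l j\<close> between
  the masses \<open>j\<close> and \<open>j + 1\<close>.
\<close>

fun fund_C fund_B fund_A :: "(nat \<Rightarrow> real) \<Rightarrow> (nat \<Rightarrow> real) \<Rightarrow> nat \<Rightarrow> real poly" where
  "fund_C m l 0 = 1"
| "fund_C m l (Suc j) = fund_C m l j + smult (l j) (fund_B m l j) + smult ((l j)\<^sup>2 / 2) (fund_A m l j)"
| "fund_B m l 0 = 0"
| "fund_B m l (Suc j) = fund_B m l j + smult (l j) (fund_A m l j)"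
| "fund_A m l 0 = [:0, - 2 * m 0:]"
| "fund_A m l (Suc j) = fund_A m l j + [:0, - 2 * m (Suc j):] * fund_C m l (Suc j)"

text \<open>
  The row vector \<open>e G(r 0) L(h 0) \<dots> G(r (k - 1)) L(h (k - 1))\<close>; each row of the transfer matrix
  \<open>S\<close> is obtained from the corresponding unit vector \<open>e\<close>.
\<close>

fun trans1 trans2 trans3 :: "(nat \<Rightarrow> real) \<Rightarrow> (nat \<Rightarrow> real) \<Rightarrow> real \<times> real \<times> real \<Rightarrow> nat \<Rightarrow> real poly" where
  "trans1 r h e 0 = [:fst e:]"
| "trans2 r h e 0 = [:fst (snd e):]"
| "trans3 r h e 0 = [:snd (snd e):]"
| "trans1 r h e (Suc k) = trans1 r h e k + [:0, - 2 * r k:] * trans3 r h e k"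
| "trans2 r h e (Suc k) = trans2 r h e k + smult (h k) (trans1 r h e (Suc k))"
| "trans3 r h e (Suc k) = trans3 r h e k + smult (h k) (trans2 r h e k)
      + smult ((h k)\<^sup>2 / 2) (trans1 r h e (Suc k))"

lemma degree_fund:
  "degree (fund_C m l j) \<le> j \<and> degree (fund_B m l j) \<le> j \<and> degree (fund_A m l j) \<le> Suc j"
proof (induction j)
  case (Suc j)
  have C: "degree (fund_C m l (Suc j)) \<le> Suc j"
    using Suc by (auto intro!: degree_add_le order.trans[OF degree_smult_le])
  have B: "degree (fund_B m l (Suc j)) \<le> Suc j"
    using Suc by (auto intro!: degree_add_le order.trans[OF degree_smult_le])
  have "degree ([:0, - 2 * m (Suc j):] * fund_C m l (Suc j)) \<le> 1 + Suc j"
    using C by (intro order.trans[OF degree_mult_le] add_mono) auto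
  then have "degree (fund_A m l (Suc j)) \<le> Suc (Suc j)"
    unfolding fund_A.simps using Suc by (intro degree_add_le) auto
  then show ?case using C B by blast
qed auto

lemma coeff_fund_A: "coeff (fund_A m l j) (Suc j) = - 2 * m j * coeff (fund_C m l j) j"
  using degree_fund[of m l "j - 1"] by (cases j) (auto simp del: fund_C.simps(2) simp: coeff_eq_0)

lemma coeff_fund_C_nonzero:
  assumes "\<And>i. i < j \<Longrightarrow> m i > 0" "\<And>i. i < j \<Longrightarrow> l i > 0"
  shows "coeff (fund_C m l j) j \<noteq> 0"
  using assms
proof (induction j)
  case (Suc j)
  have "coeff (fund_C m l (Suc j)) (Suc j) = (l j)\<^sup>2 / 2 * coeff (fund_A m l j) (Suc j)"
    using degree_fund[of m l j] by (simp add: coeff_eq_0)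
  then show ?case
    using Suc.IH Suc.prems(1)[of j] Suc.prems(2)[of j] Suc.prems
    unfolding coeff_fund_A by force
qed auto

lemma fund_at_0:
  "poly (fund_C m l j) 0 = 1 \<and> poly (fund_B m l j) 0 = 0 \<and> poly (fund_A m l j) 0 = 0"
  by (induction j) auto

text \<open>This is the derivative of \<open>A\<close> at 0; through it the total mass enters the
  residue at 0.\<close>

lemma coeff_1_fund_A: "coeff (fund_A m l j) 1 = - 2 * (\<Sum>i\<le>j. m i)"
proof (induction j)
  case (Suc j)
  have "coeff (fund_C m l (Suc j)) 0 = 1"
    using fund_at_0 by (metis poly_0_coeff_0)
  with Suc show ?case
    by (simp del: fund_C.simps add: algebra_simps)
qed auto

text \<open>The starting vector \<open>(1, 0, - 2 m z)\<close> is isotropic, and each factor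
  \<open>L\<close> and \<open>G\<close> preserves the pairing.\<close>

lemma fund_isotropic:
  "poly (fund_C m l j) z * poly (fund_A m l j) (- z) - poly (fund_B m l j) z * poly (fund_B m l j) (- z)
     + poly (fund_A m l j) z * poly (fund_C m l j) (- z) = 0"
proof (induction j)
  case (Suc j)
  have "poly (fund_C m l (Suc j)) z * poly (fund_A m l (Suc j)) (- z)
      - poly (fund_B m l (Suc j)) z * poly (fund_B m l (Suc j)) (- z)
      + poly (fund_A m l (Suc j)) z * poly (fund_C m l (Suc j)) (- z)
    = poly (fund_C m l j) z * poly (fund_A m l j) (- z) - poly (fund_B m l j) z * poly (fund_B m l j) (- z)
     + poly (fund_A m l j) z * poly (fund_C m l j) (- z)"
    by (simp add: algebra_simps power2_eq_square)
  with Suc show ?case by simp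
qed auto

section \<open>Degrees, leading coefficients and minors of the transfer matrix\<close>

lemma degree_trans:
  "degree (trans1 r h e k) \<le> k \<and> degree (trans2 r h e k) \<le> k \<and> degree (trans3 r h e k) \<le> k"
proof (induction k)
  case (Suc k)
  have "degree ([:0, - 2 * r k:] * trans3 r h e k) \<le> 1 + k"
    using Suc by (intro order.trans[OF degree_mult_le] add_mono) auto
  then have 1: "degree (trans1 r h e (Suc k)) \<le> Suc k"
    unfolding trans1.simps using Suc by (intro degree_add_le) auto
  have 2: "degree (trans2 r h e (Suc k)) \<le> Suc k"
    unfolding trans2.simps using Suc 1
    by (intro degree_add_le order.trans[OF degree_smult_le]) (auto simp del: trans1.simps)
  have "degree (trans3 r h e (Suc k)) \<le> Suc k"
    unfolding trans3.simps using Suc 1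
    by (intro degree_add_le order.trans[OF degree_smult_le]) (auto simp del: trans1.simps)
  then show ?case using 1 2 by blast
qed auto

lemma coeff_trans:
  shows "coeff (trans1 r h e (Suc k)) (Suc k) = - 2 * r k * coeff (trans3 r h e k) k"
    and "coeff (trans2 r h e (Suc k)) (Suc k) = h k * coeff (trans1 r h e (Suc k)) (Suc k)"
    and "coeff (trans3 r h e (Suc k)) (Suc k) = (h k)\<^sup>2 / 2 * coeff (trans1 r h e (Suc k)) (Suc k)"
  using degree_trans[of r h e k] by (auto simp: coeff_eq_0)

lemma coeff_trans3_nonzero:
  assumes "\<And>i. i < k \<Longrightarrow> r i > 0" "\<And>i. i < k \<Longrightarrow> h i > 0" "snd (snd e) \<noteq> 0"
  shows "coeff (trans3 r h e k) k \<noteq> 0"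
  using assms(1,2)
proof (induction k)
  case (Suc k)
  then show ?case
    using Suc.prems(1)[of k] Suc.prems(2)[of k]
    unfolding coeff_trans(3) coeff_trans(1) by force
qed (use assms(3) in auto)

text \<open>Components are ordered as \<open>(C, B, A)\<close>, so \<open>eA\<close> yields the
  third row of \<open>S\<close> and \<open>eB\<close> the second.\<close>

abbreviation (input) "eC \<equiv> (1, 0, 0) :: real \<times> real \<times> real"
abbreviation (input) "eB \<equiv> (0, 1, 0) :: real \<times> real \<times> real"
abbreviation (input) "eA \<equiv> (0, 0, 1) :: real \<times> real \<times> real"

text \<open>At \<open>z = 0\<close> every \<open>G\<close> is the identity, and the factors
  \<open>L\<close> are unit upper triangular, so they fix the last unit row vector.\<close>

lemma trans_eA_at_0:
  "poly (trans1 r h eA k) 0 = 0 \<and> poly (trans2 r h eA k) 0 = 0 \<and> poly (trans3 r h eA k) 0 = 1"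
  by (induction k) auto

lemma trans_eB_at_0: "poly (trans1 r h eB k) 0 = 0 \<and> poly (trans2 r h eB k) 0 = 1"
  by (induction k) auto

text \<open>Multiplying the row bounds would only give \<open>2 * k\<close>. But the three minors
  satisfy the recursion of \<open>trans1\<close>, \<open>trans2\<close>, \<open>trans3\<close> with
  \<open>z\<close> replaced by \<open>- z\<close>, so they grow no faster than single
  entries.\<close>

lemma degree_minors:
  fixes r h d e
  defines "a1 \<equiv> trans1 r h d" and "a2 \<equiv> trans2 r h d" and "a3 \<equiv> trans3 r h d"
    and "b1 \<equiv> trans1 r h e" and "b2 \<equiv> trans2 r h e" and "b3 \<equiv> trans3 r h e"
  shows "degree (b1 k * a2 k - a1 k * b2 k) \<le> k \<and> degree (b1 k * a3 k - a1 k * b3 k) \<le> k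
    \<and> degree (b2 k * a3 k - a2 k * b3 k) \<le> k"
proof (induction k)
  case 0
  then show ?case unfolding a1_def a2_def a3_def b1_def b2_def b3_def by simp
next
  case (Suc k)
  let ?p = "b1 k * a2 k - a1 k * b2 k"
  let ?q = "b1 k * a3 k - a1 k * b3 k"
  let ?s = "b2 k * a3 k - a2 k * b3 k"
  let ?p' = "?p + [:0, 2 * r k:] * ?s"
  have "degree ([:0, 2 * r k:] * ?s) \<le> 1 + k"
    using Suc by (intro order.trans[OF degree_mult_le] add_mono) auto
  then have d: "degree ?p' \<le> Suc k"
    using Suc by (intro degree_add_le) auto
  note defs = a1_def a2_def a3_def b1_def b2_def b3_def
  have 1: "b1 (Suc k) * a2 (Suc k) - a1 (Suc k) * b2 (Suc k) = ?p'"
    by (intro poly_eqI_poly) (simp add: defs algebra_simps power2_eq_square)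
  have 2: "b1 (Suc k) * a3 (Suc k) - a1 (Suc k) * b3 (Suc k) = smult (h k) ?p' + ?q"
    by (intro poly_eqI_poly) (simp add: defs algebra_simps power2_eq_square)
  have 3: "b2 (Suc k) * a3 (Suc k) - a2 (Suc k) * b3 (Suc k) =
     smult ((h k)\<^sup>2 / 2) ?p' + smult (h k) ?q + ?s"
    by (intro poly_eqI_poly) (simp add: defs algebra_simps power2_eq_square)
  show ?case
    unfolding 1 2 3 using d Suc
    by (auto intro!: degree_add_le order.trans[OF degree_smult_le])
qed

section \<open>The vector at an earlier mass and the vector at the last mass\<close>

locale string_data =
  fixes N :: nat and m l :: "nat \<Rightarrow> real"
  assumes m_pos: "j \<le> N \<Longrightarrow> m j > 0" and l_pos: "j < N \<Longrightarrow> l j > 0"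
begin

abbreviation "C \<equiv> fund_C m l"
abbreviation "B \<equiv> fund_B m l"
abbreviation "A \<equiv> fund_A m l"

text \<open>Masses and lengths counted from the right end.\<close>

definition "r k = m (N - k)"
definition "h k = l (N - Suc k)"

text \<open>Two rows of \<open>U = S u\<close>. The product of row and column does not depend on
  \<open>k\<close>: each step moves one factor \<open>G L\<close> from the column to the
  row.\<close>

lemma A_expand:
  assumes "k \<le> N"
  shows "A N = C (N - k) * trans1 r h eA k + B (N - k) * trans2 r h eA k + A (N - k) * trans3 r h eA k"
    and "B N = C (N - k) * trans1 r h eB k + B (N - k) * trans2 r h eB k + A (N - k) * trans3 r h eB k"
proof -
  have "C (N - k) * trans1 r h e k + B (N - k) * trans2 r h e k + A (N - k) * trans3 r h e k
     = C N * trans1 r h e 0 + B N * trans2 r h e 0 + A N * trans3 r h e 0" for e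
    using assms
  proof (induction k)
    case (Suc k)
    define j where "j = N - Suc k"
    have Nk: "N - k = Suc j"
      using Suc.prems by (simp add: j_def)
    then have j: "N - k = Suc j" "r k = m (Suc j)" "h k = l j"
      by (simp_all add: j_def r_def h_def)
    have "C j * trans1 r h e (Suc k) + B j * trans2 r h e (Suc k) + A j * trans3 r h e (Suc k)
      = C (Suc j) * trans1 r h e k + B (Suc j) * trans2 r h e k + A (Suc j) * trans3 r h e k"
      by (intro poly_eqI_poly) (simp add: j algebra_simps power2_eq_square)
    with Suc show ?case by (simp only: j j_def[symmetric]) 
  qed simp
  note * = this
  show "A N = C (N - k) * trans1 r h eA k + B (N - k) * trans2 r h eA k + A (N - k) * trans3 r h eA k"
    unfolding * by simp
  show "B N = C (N - k) * trans1 r h eB k + B (N - k) * trans2 r h eB k + A (N - k) * trans3 r h eB k"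
    unfolding * by simp
qed

text \<open>The inverse relation to \<open>U = S u\<close>: as \<open>S\<close> preserves the
  pairing, its inverse consists, up to signs and order, of the transposed entries of
  \<open>S\<close> at \<open>- z\<close>.\<close>

lemma C_pairing:
  assumes "k \<le> N"
  shows "poly (C (N - k)) z = poly (C N) z * poly (trans3 r h eA k) (- z)
      - poly (B N) z * poly (trans3 r h eB k) (- z) + poly (A N) z * poly (trans3 r h eC k) (- z)
    \<and> - poly (B (N - k)) z = poly (C N) z * poly (trans2 r h eA k) (- z)
      - poly (B N) z * poly (trans2 r h eB k) (- z) + poly (A N) z * poly (trans2 r h eC k) (- z)
    \<and> poly (A (N - k)) z = poly (C N) z * poly (trans1 r h eA k) (- z)
      - poly (B N) z * poly (trans1 r h eB k) (- z) + poly (A N) z * poly (trans1 r h eC k) (- z)"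
  using assms
proof (induction k)
  case (Suc k)
  define j where "j = N - Suc k"
  have Nk: "N - k = Suc j"
    using Suc.prems by (simp add: j_def)
  then have j: "N - k = Suc j" "r k = m (Suc j)" "h k = l j"
    by (simp_all add: j_def r_def h_def)
  note IH = Suc.IH[unfolded j, THEN conjunct1] Suc.IH[unfolded j, THEN conjunct2, THEN conjunct1]
    Suc.IH[unfolded j, THEN conjunct2, THEN conjunct2]
  have kN: "k \<le> N" using Suc.prems by simp
  \<comment> \<open>Pairing of \<open>U\<close> at \<open>z\<close> with a column of
    \<open>S\<close> at \<open>- z\<close>; the argument \<open>t\<close> selects the
    column.\<close>
  let ?f = "\<lambda>t :: real \<times> real \<times> real \<Rightarrow> nat \<Rightarrow> real poly. \<lambda>k. poly (C N) z * poly (t eA k) (- z)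
      - poly (B N) z * poly (t eB k) (- z) + poly (A N) z * poly (t eC k) (- z)"
  \<comment> \<open>Undoing first \<open>G\<close> and then \<open>L\<close> expresses the vector at
    \<open>j\<close> through the one at \<open>Suc j\<close>.\<close>
  have A: "poly (A j) z = poly (A (Suc j)) z + 2 * m (Suc j) * z * poly (C (Suc j)) z"
    by simp
  have B: "poly (B j) z = poly (B (Suc j)) z - l j * poly (A j) z"
    by simp
  have C: "poly (C j) z = poly (C (Suc j)) z - l j * poly (B (Suc j)) z + (l j)\<^sup>2 / 2 * poly (A j) z"
    by (simp add: power2_eq_square algebra_simps)
  have 1: "?f (trans1 r h) (Suc k) = poly (A j) z"
    unfolding A IH(1)[OF kN] IH(3)[OF kN] trans1.simps j
    by (simp add: algebra_simps)
  have 2: "?f (trans2 r h) (Suc k) = - poly (B j) z"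
  proof -
    have "?f (trans2 r h) (Suc k) = ?f (trans2 r h) k + l j * ?f (trans1 r h) (Suc k)"
      unfolding trans2.simps j by (simp add: algebra_simps del: trans1.simps)
    then show ?thesis
      unfolding 1 IH(2)[OF kN, symmetric] B by simp
  qed
  have 3: "?f (trans3 r h) (Suc k) = poly (C j) z"
  proof -
    have "?f (trans3 r h) (Suc k) = ?f (trans3 r h) k + l j * ?f (trans2 r h) k
        + (l j)\<^sup>2 / 2 * ?f (trans1 r h) (Suc k)"
      unfolding trans3.simps j by (simp add: algebra_simps del: trans1.simps)
    then show ?thesis
      unfolding 1 IH(2)[OF kN, symmetric] IH(1)[OF kN, symmetric] C
      by (simp del: fund_A.simps fund_B.simps fund_C.simps)
  qed
  show ?case
    unfolding j_def[symmetric] by (simp only: 1 2 3)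
qed (simp add: poly_pCons)

end

section \<open>Approximation of the Weyl function\<close>

locale spectral_string = string_data +
  fixes lam b :: "nat \<Rightarrow> real"
  assumes lam_inj: "inj_on lam {1..N}"
    and lam_pos: "p \<in> {1..N} \<Longrightarrow> lam p > 0"
    and A_lam: "p \<in> {1..N} \<Longrightarrow> poly (A N) (lam p) = 0"
    and B_over_A: "poly (A N) z \<noteq> 0 \<Longrightarrow>
      poly (B N) z / poly (A N) z = (\<Sum>p=1..N. b p / (z - lam p))"
begin

text \<open>The zeros of \<open>A N\<close>, with index 0 for the zero at the origin, whose residue
  gives rise to \<open>1 / (2 M)\<close>.\<close>

definition "node p = (if p = 0 then 0 else lam p)"
definition "lc = coeff (A N) (Suc N)"
text \<open>The derivative of \<open>A N\<close> at \<open>node p\<close>.\<close>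

definition "dA p = lc * (\<Prod>q\<in>{0..N}-{p}. node p - node q)"
definition "total_mass = (\<Sum>i\<le>N. m i)"

section \<open>Residues at the zeros of \<open>A N\<close>\<close>

lemma inj_node: "inj_on node {0..N}"
  using lam_inj lam_pos unfolding inj_on_def node_def
  by (metis One_nat_def Suc_leI atLeastAtMost_iff less_irrefl neq0_conv)

lemma lc_nonzero: "lc \<noteq> 0"
  using coeff_fund_C_nonzero[of N m l] m_pos[of N] m_pos l_pos unfolding lc_def coeff_fund_A by force

lemma dA_nonzero: "p \<le> N \<Longrightarrow> dA p \<noteq> 0"
  using lc_nonzero inj_node unfolding dA_def by (auto simp: inj_on_def)

text \<open>The coefficients at \<open>Suc N\<close> agree, so the difference has degree at most
  \<open>N\<close>; it vanishes at \<open>N + 1\<close> points.\<close>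

lemma A_factor: "A N = smult lc (\<Prod>q\<in>{0..N}. [:- node q, 1:])"
proof -
  let ?P = "\<Prod>q\<in>{0..N}. [:- node q, 1:]"
  have deg: "degree ?P = Suc N"
    by (subst degree_prod_eq_sum_degree) auto
  moreover have "lead_coeff ?P = 1"
    by (simp add: lead_coeff_prod)
  ultimately have top: "coeff ?P (Suc N) = 1" by simp
  show ?thesis
  proof (rule poly_eqI_degree_lead_coeff[of _ "Suc N" _ "node ` {0..N}"])
    show "coeff (A N) (Suc N) = coeff (smult lc ?P) (Suc N)"
      using top by (simp add: lc_def)
    show "Suc N \<le> card (node ` {0..N})"
      using card_image[OF inj_node] by simp
    show "degree (A N) \<le> Suc N" using degree_fund by blast
    show "degree (smult lc ?P) \<le> Suc N" using deg by simp
    fix z assume "z \<in> node ` {0..N}"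
    then obtain p where p: "p \<le> N" "z = node p" by auto
    then have "poly (A N) z = 0"
      using A_lam[of p] fund_at_0 by (auto simp: node_def)
    moreover have "poly ?P z = 0"
      using p by (auto simp: poly_prod)
    ultimately show "poly (A N) z = poly (smult lc ?P) z" by simp
  qed
qed

lemma A_split:
  assumes "p \<le> N"
  shows "A N = [:- node p, 1:] * smult lc (\<Prod>q\<in>{0..N}-{p}. [:- node q, 1:])"
  unfolding A_factor using assms by (subst prod.remove[of _ p]) auto

lemma dA_0: "dA 0 = - 2 * total_mass"
proof -
  have "coeff (A N) 1 = dA 0"
    by (subst A_split[of 0]) (auto simp: node_def dA_def poly_prod poly_0_coeff_0[symmetric])
  then show ?thesis
    unfolding coeff_1_fund_A total_mass_def by simp
qed

text \<open>The finite residues of \<open>f / A\<close> add up to minus the residue at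
  infinity.\<close>

lemma residue_sum:
  assumes "degree f \<le> N"
  shows "(\<Sum>p=0..N. poly f (node p) / dA p) = coeff f N / lc"
proof -
  have "coeff f N = (\<Sum>p=0..N. poly f (node p) / (\<Prod>q\<in>{0..N}-{p}. node p - node q))"
    using coeff_lagrange[OF _ inj_node, of f] assms by simp
  then show ?thesis
    by (simp add: dA_def sum_divide_distrib mult.commute)
qed

lemma residue_expansion:
  assumes f: "degree f \<le> N" and z: "poly (A N) z \<noteq> 0"
  shows "poly f z / poly (A N) z = (\<Sum>p=0..N. poly f (node p) / dA p / (z - node p))"
proof -
  have A: "poly (A N) z = (z - node p) * (lc * (\<Prod>q\<in>{0..N}-{p}. z - node q))" if "p \<le> N" for p
    by (subst A_split[OF that]) (simp add: poly_prod left_diff_distrib mult.left_commute)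
  have "poly f z = (\<Sum>p=0..N. poly f (node p) / (\<Prod>q\<in>{0..N}-{p}. node p - node q)
      * (\<Prod>q\<in>{0..N}-{p}. z - node q))"
    by (subst poly_eq_lagrange[OF _ inj_node, of f]) (use f in \<open>simp_all add: poly_sum poly_prod\<close>)
  then have "poly f z / poly (A N) z = (\<Sum>p=0..N. poly f (node p) / (\<Prod>q\<in>{0..N}-{p}. node p - node q)
      * (\<Prod>q\<in>{0..N}-{p}. z - node q) / poly (A N) z)"
    by (simp add: sum_divide_distrib)
  also have "\<dots> = (\<Sum>p=0..N. poly f (node p) / dA p / (z - node p))"
  proof (rule sum.cong[OF refl])
    fix p assume "p \<in> {0..N}"
    then show "poly f (node p) / (\<Prod>q\<in>{0..N}-{p}. node p - node q)
      * (\<Prod>q\<in>{0..N}-{p}. z - node q) / poly (A N) z = poly f (node p) / dA p / (z - node p)"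
      using A[of p] z by (simp add: dA_def)
  qed
  finally show ?thesis .
qed

lemma B_node:
  assumes "p \<in> {1..N}"
  shows "poly (B N) (lam p) = b p * dA p"
proof -
  let ?P = "\<lambda>p. smult lc (\<Prod>q\<in>{0..N}-{p}. [:- node q, 1:])"
  let ?S = "\<Sum>p=1..N. smult (b p) (?P p)"
  \<comment> \<open>The expansion of \<open>B / A\<close> is only given off the zeros of
    \<open>A N\<close>. Multiplying by \<open>A N\<close> makes the identity hold everywhere, and
    cancelling it gives \<open>B N = ?S\<close>.\<close>
  have "A N * (B N - ?S) = 0"
  proof (intro poly_eqI_poly)
    fix z
    have "poly (B N) z = poly ?S z" if z: "poly (A N) z \<noteq> 0"
    proof -
      have "poly (B N) z = (\<Sum>p=1..N. b p / (z - lam p)) * poly (A N) z"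
        using B_over_A[OF z] z by (simp add: field_simps)
      also have "\<dots> = (\<Sum>p=1..N. b p / (z - lam p) * poly (A N) z)"
        by (rule sum_distrib_right)
      also have "\<dots> = (\<Sum>p=1..N. b p * poly (?P p) z)"
      proof (rule sum.cong[OF refl])
        fix p assume p: "p \<in> {1..N}"
        then have "poly (A N) z = (z - lam p) * poly (?P p) z"
          by (subst A_split[of p]) (auto simp: node_def[of p] algebra_simps)
        then show "b p / (z - lam p) * poly (A N) z = b p * poly (?P p) z"
          using z by auto
      qed
      finally show ?thesis
        by (simp add: poly_sum mult.assoc)
    qed
    then show "poly (A N * (B N - ?S)) z = poly 0 z" by auto
  qed
  moreover have "A N \<noteq> 0"
    using lc_nonzero unfolding lc_def by auto
  ultimately have "B N = ?S" by simp
  then have "poly (B N) (lam p) = (\<Sum>s=1..N. b s * poly (?P s) (lam p))"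
    by (simp add: poly_sum mult.assoc)
  also have "\<dots> = (\<Sum>s=1..N. if s = p then b p * dA p else 0)"
  proof (rule sum.cong[OF refl])
    fix s assume s: "s \<in> {1..N}"
    show "b s * poly (?P s) (lam p) = (if s = p then b p * dA p else 0)"
    proof (cases "s = p")
      case True
      with assms show ?thesis by (simp add: poly_prod dA_def node_def[of p])
    next
      case False
      then have "(\<Prod>q\<in>{0..N}-{s}. lam p - node q) = 0"
        using assms by (intro prod_zero) (auto simp: node_def intro!: bexI[of _ p])
      with False show ?thesis by (simp add: poly_prod)
    qed
  qed
  finally show ?thesis using assms by simp
qed

lemma A_neg_nonzero: "z > 0 \<Longrightarrow> poly (A N) (- z) \<noteq> 0"
proof -
  assume z: "z > 0"
  have "- z - node q < 0" if "q \<in> {0..N}" for q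
    using z lam_pos[of q] that by (cases "q = 0") (auto simp: node_def intro: add_pos_pos)
  then have "(\<Prod>q\<in>{0..N}. - z - node q) \<noteq> 0"
    by (metis finite_atLeastAtMost less_irrefl prod_zero_iff)
  then show ?thesis
    using lc_nonzero unfolding A_factor by (simp add: poly_prod algebra_simps)
qed

text \<open>For \<open>z > 0\<close> this is \<open>- B / A\<close> evaluated at
  \<open>- z\<close>.\<close>

definition "W z = (\<Sum>q=1..N. b q / (z + lam q))"

lemma B_over_A_neg: "z > 0 \<Longrightarrow> poly (B N) (- z) = - W z * poly (A N) (- z)"
proof -
  assume "z > 0"
  note A = A_neg_nonzero[OF this]
  have "(\<Sum>p=1..N. b p / (- z - lam p)) = - W z"
    unfolding W_def sum_negf[symmetric]
    by (rule sum.cong[OF refl]) (metis minus_add_distrib divide_minus_right uminus_add_conv_diff add.commute diff_minus_eq_add minus_diff_eq)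
  then show ?thesis
    using B_over_A[OF A] A by (simp add: field_simps)
qed

text \<open>At a zero of \<open>A\<close>, isotropy reduces to
  \<open>C(z) A(- z) = B(z) B(- z)\<close>. Hence the residues of \<open>C / A\<close> are
  determined by \<open>B / A\<close>, and the kernel \<open>1 / (lam p + lam q)\<close>
  appears.\<close>

lemma C_node:
  assumes "p \<in> {1..N}"
  shows "poly (C N) (lam p) = - b p * dA p * W (lam p)"
proof -
  have "poly (C N) (lam p) * poly (A N) (- lam p) =
      poly (B N) (lam p) * poly (B N) (- lam p)"
    using fund_isotropic[of m l N "lam p"] A_lam[OF assms] by simp
  also have "\<dots> = - b p * dA p * W (lam p) * poly (A N) (- lam p)"
    using B_over_A_neg B_node[OF assms] lam_pos[OF assms] by simp
  finally show ?thesis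
    using mult_right_cancel[OF A_neg_nonzero[OF lam_pos[OF assms]]] by blast
qed

text \<open>The degree bound lets \<open>(B s - A t) / A\<close> be expanded in partial fractions at
  \<open>- z\<close>. The residue at \<open>lam q\<close> is \<open>b q * poly s (lam q)\<close>,
  and there is none at 0 since \<open>B\<close> and \<open>A\<close> vanish there.\<close>

lemma approximation_error:
  assumes "degree (B N * s - A N * t) \<le> N" and z: "z > 0"
  shows "W z * poly s (- z) + poly t (- z) = (\<Sum>q=1..N. b q * poly s (lam q) / (z + lam q))"
proof -
  let ?E = "B N * s - A N * t"
  note A = A_neg_nonzero[OF z]
  have E0: "poly ?E (node 0) = 0"
    using fund_at_0[of m l N] by (simp add: node_def)
  have Eq: "poly ?E (node q) = b q * dA q * poly s (lam q)" if "q \<in> {1..N}" for q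
    using that A_lam[OF that] B_node[OF that] by (simp add: node_def)
  have "poly ?E (- z) / poly (A N) (- z) = (\<Sum>p=0..N. poly ?E (node p) / dA p / (- z - node p))"
    by (rule residue_expansion[OF assms(1) A])
  also have "\<dots> = (\<Sum>p=1..N. poly ?E (node p) / dA p / (- z - node p))"
    using E0 by (simp add: sum.atLeast_Suc_atMost)
  also have "\<dots> = (\<Sum>q=1..N. - (b q * poly s (lam q) / (z + lam q)))"
  proof (rule sum.cong[OF refl])
    fix q assume q: "q \<in> {1..N}"
    have neg: "- z - lam q = - (z + lam q)" by simp
    show "poly ?E (node q) / dA q / (- z - node q) = - (b q * poly s (lam q) / (z + lam q))"
      using q dA_nonzero[of q] unfolding Eq[OF q] by (auto simp: node_def neg simp del: minus_add_distrib)
  qed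
  finally have *: "poly ?E (- z) / poly (A N) (- z) = - (\<Sum>q=1..N. b q * poly s (lam q) / (z + lam q))"
    by (simp add: sum_negf)
  have "poly ?E (- z) = - (W z * poly s (- z) + poly t (- z)) * poly (A N) (- z)"
    using B_over_A_neg[OF z] by (simp add: algebra_simps)
  then show ?thesis
    using * A by simp
qed

lemma coeff_A_split: "k \<le> N \<Longrightarrow> lc = coeff (A (N - k)) (Suc (N - k)) * coeff (trans3 r h eA k) k"
proof -
  assume k: "k \<le> N"
  let ?j = "N - k"
  have Suc: "Suc N = Suc ?j + k" using k by simp
  have d: "degree (C ?j) \<le> ?j" "degree (B ?j) \<le> ?j" "degree (A ?j) \<le> Suc ?j"
    using degree_fund by blast+
  have t: "degree (trans1 r h eA k) \<le> k" "degree (trans2 r h eA k) \<le> k" "degree (trans3 r h eA k) \<le> k"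
    using degree_trans by blast+
  have "coeff (C ?j * trans1 r h eA k) (Suc N) = 0"
    using d(1) t(1) k by (intro coeff_eq_0 le_less_trans[OF degree_mult_le]) linarith
  moreover have "coeff (B ?j * trans2 r h eA k) (Suc N) = 0"
    using d(2) t(2) k by (intro coeff_eq_0 le_less_trans[OF degree_mult_le]) linarith
  moreover have "coeff (A ?j * trans3 r h eA k) (Suc N) = coeff (A ?j) (Suc ?j) * coeff (trans3 r h eA k) k"
    unfolding Suc by (rule coeff_mult_top[OF d(3) t(3)])
  ultimately show ?thesis
    unfolding lc_def A_expand(1)[OF k] by simp
qed

text \<open>Inserting \<open>A_expand\<close> cancels the terms with \<open>A (N - k)\<close>; the
  rest are minors of degree at most \<open>k\<close> times \<open>C\<close> and \<open>B\<close> of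
  degree at most \<open>N - k\<close>.\<close>

lemma degree_approximation3:
  assumes k: "k \<le> N"
  shows "degree (B N * trans3 r h eA k - A N * trans3 r h eB k) \<le> N"
proof -
  let ?j = "N - k"
  let ?a = "\<lambda>t. t r h eA k :: real poly" and ?b = "\<lambda>t. t r h eB k :: real poly"
  have "B N * ?a trans3 - A N * ?b trans3
    = C ?j * (?b trans1 * ?a trans3 - ?a trans1 * ?b trans3)
      + B ?j * (?b trans2 * ?a trans3 - ?a trans2 * ?b trans3)"
    unfolding A_expand[OF k] by (intro poly_eqI_poly) (simp add: algebra_simps)
  moreover have "degree (C ?j * (?b trans1 * ?a trans3 - ?a trans1 * ?b trans3)) \<le> ?j + k"
    "degree (B ?j * (?b trans2 * ?a trans3 - ?a trans2 * ?b trans3)) \<le> ?j + k"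
    using degree_fund degree_minors
    by (blast intro: order.trans[OF degree_mult_le] add_mono)+
  ultimately show ?thesis
    using k by (simp add: degree_add_le)
qed

text \<open>
  The second column only approximates to order \<open>O(1)\<close>; dividing by \<open>z\<close>, which \<open>S\<^sub>3\<^sub>2(0) = 0\<close> and
  \<open>S\<^sub>2\<^sub>2(0) = 1\<close> permit up to the term \<open>A N\<close>, restores the order \<open>O(1 / z)\<close>.
\<close>

lemma degree_approximation2:
  assumes k: "k \<le> N" and s: "trans2 r h eA k = pCons 0 s" and t: "trans2 r h eB k = pCons 1 t"
  shows "degree (B N * s - A N * t) \<le> N"
proof -
  let ?j = "N - k"
  let ?a = "\<lambda>t. t r h eA k :: real poly" and ?b = "\<lambda>t. t r h eB k :: real poly"
  have eq: "pCons 0 (B N * s - A N * t) = A N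
      + (C ?j * (?b trans1 * ?a trans2 - ?a trans1 * ?b trans2)
      - A ?j * (?b trans2 * ?a trans3 - ?a trans2 * ?b trans3))"
  proof -
    have "pCons 0 (B N * s - A N * t) = A N + (B N * ?a trans2 - A N * ?b trans2)"
      unfolding s t by (intro poly_eqI_poly) (simp add: algebra_simps)
    also have "B N * ?a trans2 - A N * ?b trans2
      = C ?j * (?b trans1 * ?a trans2 - ?a trans1 * ?b trans2)
      - A ?j * (?b trans2 * ?a trans3 - ?a trans2 * ?b trans3)"
      unfolding A_expand[OF k] by (intro poly_eqI_poly) (simp add: algebra_simps)
    finally show ?thesis .
  qed
  have "degree (C ?j * (?b trans1 * ?a trans2 - ?a trans1 * ?b trans2)) \<le> Suc ?j + k"
    "degree (A ?j * (?b trans2 * ?a trans3 - ?a trans2 * ?b trans3)) \<le> Suc ?j + k"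
    using degree_fund degree_minors le_SucI
    by (blast intro: order.trans[OF degree_mult_le] add_mono)+
  then have "degree (pCons 0 (B N * s - A N * t)) \<le> Suc N"
    unfolding eq using k degree_fund[of m l N] by (intro degree_add_le degree_diff_le) auto
  then show ?thesis
    by (cases "B N * s - A N * t = 0") auto
qed

end

section \<open>Orthogonality and determinants\<close>

lemma sum_bimoment_coeff:
  assumes "degree f \<le> k"
  shows "(\<Sum>j\<le>k. bimoment N lam b i j * coeff f j) =
    (\<Sum>p=1..N. b p * lam p ^ i * (\<Sum>q=1..N. b q * poly f (lam q) / (lam p + lam q)))"
proof -
  have f: "poly f y = (\<Sum>j\<le>k. coeff f j * y ^ j)" for y
    unfolding poly_altdef using assms
    by (intro sum.mono_neutral_left) (auto simp: coeff_eq_0)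
  have "(\<Sum>j\<le>k. bimoment N lam b i j * coeff f j) =
    (\<Sum>j\<le>k. \<Sum>p=1..N. \<Sum>q=1..N. b p * lam p ^ i * (b q * (coeff f j * lam q ^ j) / (lam p + lam q)))"
    unfolding bimoment_def sum_distrib_right by (intro sum.cong refl) simp
  also have "\<dots> = (\<Sum>p=1..N. \<Sum>q=1..N. \<Sum>j\<le>k. b p * lam p ^ i * (b q * (coeff f j * lam q ^ j) / (lam p + lam q)))"
    by (rule trans[OF sum.swap sum.cong[OF refl sum.swap]])
  also have "\<dots> = (\<Sum>p=1..N. b p * lam p ^ i * (\<Sum>q=1..N. b q * poly f (lam q) / (lam p + lam q)))"
    unfolding f sum_distrib_left sum_divide_distrib by (rule refl)
  finally show ?thesis .
qed

lemma bimoment_commute: "bimoment N lam b i j = bimoment N lam b j i"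
  unfolding bimoment_def by (subst sum.swap) (simp add: ac_simps)

text \<open>By symmetry of the bimoments, shifting the column index is the transpose of shifting the
  row index.\<close>

lemma det_bimoment_shift:
  "det (mat k k (\<lambda>(i, j). bimoment N lam b i (Suc j))) = D_det N lam b k"
proof -
  have "det (mat k k (\<lambda>(i, j). bimoment N lam b i (Suc j))) =
      det (transpose_mat (mat k k (\<lambda>(i, j). bimoment N lam b (Suc i) j)))"
    by (intro arg_cong[of _ _ det] eq_matI) (auto simp: bimoment_commute)
  then show ?thesis
    by (subst (asm) det_transpose) (auto simp: D_det_def)
qed

context spectral_string
begin

definition "I i j = (if i = 0 \<and> j = 0 then bimoment N lam b 0 0 + 1 / (2 * total_mass) else bimoment N lam b i j)"

text \<open>The residues of \<open>z^i * C (N - k) / A N\<close> are summed: those at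
  \<open>lam p\<close> give the bimoments, the one at 0 the mass correction, and infinity the
  right-hand side.\<close>

lemma orthogonality:
  fixes k
  defines "q \<equiv> trans3 r h eA k"
  assumes k: "k \<le> N" and i: "i \<le> k"
  shows "(\<Sum>j\<le>k. I i j * coeff q j) = (if i = k then 1 / (2 * m (N - k) * coeff q k) else 0)"
proof -
  let ?u = "C (N - k)"
  let ?f = "monom 1 i * ?u"
  let ?S = "\<lambda>p. \<Sum>s=1..N. b s * poly q (lam s) / (lam p + lam s)"
  \<comment> \<open>At \<open>lam p\<close> the \<open>A N\<close> term of the pairing vanishes, and
    \<open>B\<close> and \<open>C\<close> share the factor \<open>b p * dA p\<close>; what remains
    is an approximation error.\<close>
  have u: "poly ?u (lam p) / dA p = - (b p * ?S p)" if p: "p \<in> {1..N}" for p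
  proof -
    have "poly ?u (lam p) = - b p * dA p * (W (lam p) * poly q (- lam p) + poly (trans3 r h eB k) (- lam p))"
      using C_pairing[OF k, of "lam p"] A_lam[OF p] B_node[OF p] C_node[OF p]
      by (simp add: q_def algebra_simps)
    also have "\<dots> = - b p * dA p * ?S p"
      using approximation_error[OF degree_approximation3[OF k] lam_pos[OF p]] by (simp add: q_def)
    finally show ?thesis using dA_nonzero[of p] p by simp
  qed
  have "degree ?f \<le> i + (N - k)"
    using degree_fund[of m l "N - k"] by (intro order.trans[OF degree_mult_le] add_mono) (auto simp: degree_monom_le)
  then have f: "degree ?f \<le> N" using i k by simp
  have "coeff ?f N / lc = (\<Sum>p=0..N. poly ?f (node p) / dA p)"
    using residue_sum[OF f] by simp
  also have "\<dots> = poly ?f 0 / dA 0 + (\<Sum>p=1..N. poly ?f (lam p) / dA p)"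
    by (simp add: sum.atLeast_Suc_atMost node_def)
  also have "(\<Sum>p=1..N. poly ?f (lam p) / dA p) = - (\<Sum>p=1..N. b p * lam p ^ i * ?S p)"
    unfolding sum_negf[symmetric]
  proof (rule sum.cong[OF refl])
    fix p assume p: "p \<in> {1..N}"
    have "poly ?f (lam p) / dA p = lam p ^ i * (poly ?u (lam p) / dA p)"
      by (simp add: poly_monom)
    then show "poly ?f (lam p) / dA p = - (b p * lam p ^ i * ?S p)"
      unfolding u[OF p] by (simp add: ac_simps)
  qed
  also have "(\<Sum>p=1..N. b p * lam p ^ i * ?S p) = (\<Sum>j\<le>k. bimoment N lam b i j * coeff q j)"
    using degree_trans[of r h eA k] by (subst sum_bimoment_coeff) (auto simp: q_def)
  also have "poly ?f 0 / dA 0 = (if i = 0 then - 1 / (2 * total_mass) else 0)"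
    using fund_at_0[of m l "N - k"] by (simp add: dA_0 poly_monom)
  finally have *: "(\<Sum>j\<le>k. bimoment N lam b i j * coeff q j) + (if i = 0 then 1 / (2 * total_mass) else 0)
      = - (coeff ?f N / lc)"
    by (simp split: if_splits)
  \<comment> \<open>The correction sits in the entry \<open>(0, 0)\<close> only, so it is weighted
    by the constant coefficient of \<open>q\<close>.\<close>
  have q0: "coeff q 0 = 1"
    using trans_eA_at_0[of r h k] by (simp add: q_def poly_0_coeff_0)
  have "(\<Sum>j\<le>k. I i j * coeff q j) = (\<Sum>j\<le>k. bimoment N lam b i j * coeff q j
      + (if j = 0 then if i = 0 then 1 / (2 * total_mass) else 0 else 0))"
    by (rule sum.cong[OF refl]) (simp add: I_def q0 algebra_simps)
  also have "\<dots> = - (coeff ?f N / lc)"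
    unfolding *[symmetric] by (simp add: sum.distrib)
  \<comment> \<open>For \<open>i < k\<close> the degree of \<open>?f\<close> is below
    \<open>N\<close>. For \<open>i = k\<close> the leading coefficient of \<open>?u\<close> cancels
    against the one contained in \<open>lc\<close>.\<close>
  also have "\<dots> = (if i = k then 1 / (2 * m (N - k) * coeff q k) else 0)"
  proof (cases "i = k")
    case True
    have "coeff ?u (N - k) \<noteq> 0"
      using m_pos l_pos by (intro coeff_fund_C_nonzero) auto
    then show ?thesis
      using True k by (simp add: coeff_monom_mult coeff_A_split[OF k] coeff_fund_A q_def)
  next
    case False
    then have "coeff ?u (N - i) = 0"
      using i k degree_fund[of m l "N - k"] by (intro coeff_eq_0) linarith
    with False i k show ?thesis by (simp add: coeff_monom_mult)
  qed
  finally show ?thesis .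
qed

text \<open>Now the residues of \<open>z^i * B (N - Suc k) / A N\<close> are summed. There is none
  at 0, where \<open>B\<close> vanishes, and none at infinity, as the numerator has degree below
  \<open>N\<close>.\<close>

lemma moment_equations:
  assumes k: "Suc k \<le> N" and i: "i \<le> k" and s: "trans2 r h eA (Suc k) = pCons 0 s"
  shows "(\<Sum>j\<le>k. bimoment N lam b (Suc i) j * coeff s j) = moment N lam b i"
proof -
  let ?u = "B (N - Suc k)"
  let ?f = "monom 1 i * ?u"
  let ?S = "\<lambda>p. \<Sum>q=1..N. b q * poly s (lam q) / (lam p + lam q)"
  obtain t where t: "trans2 r h eB (Suc k) = pCons 1 t"
    using trans_eB_at_0[of r h "Suc k"] by (cases "trans2 r h eB (Suc k)") (auto simp del: trans2.simps)
  have "degree s \<le> k"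
    using degree_trans[of r h eA "Suc k"] s by (cases "s = 0") auto
  have u: "poly ?u (lam p) / dA p = b p * (1 - lam p * ?S p)" if p: "p \<in> {1..N}" for p
  proof -
    have "- poly ?u (lam p) = - b p * dA p * W (lam p) * poly (pCons 0 s) (- lam p)
        - b p * dA p * poly (pCons 1 t) (- lam p)"
      using C_pairing[OF k, of "lam p"] unfolding A_lam[OF p] B_node[OF p] C_node[OF p] s t by simp
    then have "poly ?u (lam p) = b p * dA p * (W (lam p) * poly (pCons 0 s) (- lam p) + poly (pCons 1 t) (- lam p))"
      by (simp only: distrib_left)
    \<comment> \<open>The constant term 1 of \<open>pCons 1 t\<close> is split off; it produces the
      moments.\<close>
    also have "\<dots> = b p * dA p * (1 - lam p * (W (lam p) * poly s (- lam p) + poly t (- lam p)))"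
      by (simp add: algebra_simps)
    also have "W (lam p) * poly s (- lam p) + poly t (- lam p) = ?S p"
      by (rule approximation_error[OF degree_approximation2[OF k s t] lam_pos[OF p]])
    finally show ?thesis using dA_nonzero[of p] p by simp
  qed
  have "degree ?f \<le> i + (N - Suc k)"
    using degree_fund[of m l "N - Suc k"] by (intro order.trans[OF degree_mult_le] add_mono) (auto simp: degree_monom_le)
  then have f: "degree ?f \<le> N" "degree ?f < N" using i k by simp_all
  have "0 = (\<Sum>p=0..N. poly ?f (node p) / dA p)"
    using residue_sum[OF f(1)] f(2) by (simp add: coeff_eq_0)
  also have "\<dots> = (\<Sum>p=1..N. poly ?f (lam p) / dA p)"
    using fund_at_0[of m l "N - Suc k"] by (simp add: sum.atLeast_Suc_atMost node_def)
  also have "\<dots> = (\<Sum>p=1..N. b p * lam p ^ i - b p * lam p ^ Suc i * ?S p)"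
  proof (rule sum.cong[OF refl])
    fix p assume p: "p \<in> {1..N}"
    have "poly ?f (lam p) / dA p = lam p ^ i * (poly ?u (lam p) / dA p)"
      by (simp add: poly_monom)
    then show "poly ?f (lam p) / dA p = b p * lam p ^ i - b p * lam p ^ Suc i * ?S p"
      unfolding u[OF p] by (simp add: algebra_simps)
  qed
  also have "\<dots> = moment N lam b i - (\<Sum>p=1..N. b p * lam p ^ Suc i * ?S p)"
    by (simp add: sum_subtractf moment_def)
  also have "(\<Sum>p=1..N. b p * lam p ^ Suc i * ?S p) = (\<Sum>j\<le>k. bimoment N lam b (Suc i) j * coeff s j)"
    by (rule sum_bimoment_coeff[symmetric]) fact
  finally show ?thesis by simp
qed

lemma A_det_I: "A_det N lam b total_mass k = det (mat k k (\<lambda>(i, j). I i j))"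
  by (simp add: A_det_def I_def)

lemma cramer_orthogonality:
  fixes k
  defines "c \<equiv> coeff (trans3 r h eA k) k"
  assumes k: "k \<le> N"
  shows "c \<noteq> 0"
    and "2 * m (N - k) * c * A_det N lam b total_mass (Suc k) = (-1) ^ k * D_det N lam b k"
    and "2 * m (N - k) * c\<^sup>2 * A_det N lam b total_mass (Suc k) = A_det N lam b total_mass k"
proof -
  note cr = cramer_last_unit_vector[where g = I and k = k, OF orthogonality[OF k]]
  have "coeff (trans3 r h eA k) 0 = 1"
    using trans_eA_at_0[of r h k] by (simp add: poly_0_coeff_0)
  moreover have "mat k k (\<lambda>(i, j). I i (Suc j)) = mat k k (\<lambda>(i, j). bimoment N lam b i (Suc j))"
    by (simp add: I_def)
  ultimately have 1: "A_det N lam b total_mass (Suc k) = 1 / (2 * m (N - k) * c) * (-1) ^ k * D_det N lam b k"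
    using cr(1) by (simp add: A_det_I det_bimoment_shift c_def)
  have 2: "c * A_det N lam b total_mass (Suc k) = 1 / (2 * m (N - k) * c) * A_det N lam b total_mass k"
    using cr(2) by (simp add: A_det_I c_def)
  show c: "c \<noteq> 0"
    unfolding c_def using k m_pos l_pos by (intro coeff_trans3_nonzero) (auto simp: r_def h_def)
  have "m (N - k) > 0" using m_pos by simp
  then show "2 * m (N - k) * c * A_det N lam b total_mass (Suc k) = (-1) ^ k * D_det N lam b k"
    "2 * m (N - k) * c\<^sup>2 * A_det N lam b total_mass (Suc k) = A_det N lam b total_mass k"
    using 1 2 c by (simp_all add: field_simps power2_eq_square)
qed

text \<open>Consecutive determinants have the positive ratio \<open>2 m c^2\<close>. This also
  justifies the divisions in the formulas.\<close>

lemma A_det_pos: "k \<le> Suc N \<Longrightarrow> A_det N lam b total_mass k > 0"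
proof (induction k)
  case 0
  show ?case by (simp add: A_det_def)
next
  case (Suc k)
  then have k: "k \<le> N" by simp
  let ?c = "coeff (trans3 r h eA k) k"
  have "2 * m (N - k) * ?c\<^sup>2 > 0"
    using cramer_orthogonality(1)[OF k] m_pos[of "N - k"] by simp
  moreover have "2 * m (N - k) * ?c\<^sup>2 * A_det N lam b total_mass (Suc k) > 0"
    unfolding cramer_orthogonality(3)[OF k] using Suc by simp
  ultimately show ?case by (rule zero_less_mult_pos[rotated])
qed

text \<open>Squaring the relation with \<open>D_det\<close> and inserting the one with
  \<open>c^2\<close> eliminates \<open>c\<close>.\<close>

lemma mass_formula:
  assumes k: "k \<le> N"
  shows "m (N - k) = (D_det N lam b k)\<^sup>2 / (2 * A_det N lam b total_mass (Suc k) * A_det N lam b total_mass k)"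
proof -
  let ?c = "coeff (trans3 r h eA k) k"
  have "(D_det N lam b k)\<^sup>2 = ((-1) ^ k * D_det N lam b k)\<^sup>2"
    by (simp add: power_mult_distrib flip: power_mult)
  also have "\<dots> = 2 * m (N - k) * A_det N lam b total_mass (Suc k) *
      (2 * m (N - k) * ?c\<^sup>2 * A_det N lam b total_mass (Suc k))"
    unfolding cramer_orthogonality(2)[OF k, symmetric] by (simp add: power2_eq_square)
  also have "\<dots> = m (N - k) * (2 * A_det N lam b total_mass (Suc k) * A_det N lam b total_mass k)"
    unfolding cramer_orthogonality(3)[OF k] by simp
  finally show ?thesis
    using A_det_pos[of k] A_det_pos[of "Suc k"] k by simp
qed

lemma length_formula:
  assumes k: "Suc k \<le> N"
  shows "l (N - Suc k) = - (2 * A_det N lam b total_mass (Suc k) / D'_det N lam b (Suc k))"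
proof -
  define c where "c = coeff (trans3 r h eA (Suc k)) (Suc k)"
  let ?D = "D_det N lam b (Suc k)"
  note cr = cramer_orthogonality[OF k, folded c_def]
  have sign: "(-1) ^ k * (-1) ^ k = (1 :: real)"
    by (simp flip: power_mult_distrib)
  obtain s where s: "trans2 r h eA (Suc k) = pCons 0 s"
    using trans_eA_at_0[of r h "Suc k"] by (cases "trans2 r h eA (Suc k)") (auto simp del: trans2.simps)
  have h: "h k > 0" using k l_pos by (simp add: h_def)
  have "coeff s k = coeff (trans2 r h eA (Suc k)) (Suc k)"
    unfolding s by simp
  \<comment> \<open>Both leading coefficients are multiples of that of \<open>trans1\<close>, by
    \<open>h k\<close> and \<open>(h k)^2 / 2\<close>.\<close>
  then have lead: "h k * coeff s k = 2 * c"
    unfolding c_def coeff_trans(2,3) by (simp add: power2_eq_square)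
  have "coeff s k * ?D = (-1) ^ k * D'_det N lam b (Suc k)"
    using cramer_last_component[where g = "\<lambda>i. bimoment N lam b (Suc i)" and c = "coeff s" and k = k,
        OF moment_equations[OF k _ s]]
    by (simp add: D_det_def D'_det_def cong: if_cong)
  then have "h k * ((-1) ^ k * D'_det N lam b (Suc k)) = 2 * c * ?D"
    using lead by (metis mult.assoc)
  also have "\<dots> = ((-1) ^ k * (-1) ^ k) * (2 * c * ?D)"
    by (simp only: sign mult_1)
  also have "\<dots> = (-1) ^ Suc k * 2 * c * ((-1) ^ Suc k * ?D)"
    by (simp add: ac_simps)
  also have "\<dots> = (-1) ^ Suc k * 2 * (2 * m (N - Suc k) * c\<^sup>2 * A_det N lam b total_mass (Suc (Suc k)))"
    unfolding cr(2)[symmetric] by (simp add: power2_eq_square)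
  also have "\<dots> = (-1) ^ k * (- 2 * A_det N lam b total_mass (Suc k))"
    unfolding cr(3) by simp
  finally have "(-1) ^ k * (h k * D'_det N lam b (Suc k)) = (-1) ^ k * (- 2 * A_det N lam b total_mass (Suc k))"
    by (simp only: mult.left_commute)
  then have "h k * D'_det N lam b (Suc k) = - 2 * A_det N lam b total_mass (Suc k)"
    by (subst (asm) mult_left_cancel) simp_all
  \<comment> \<open>A vanishing \<open>D'_det\<close> would force the positive \<open>A_det\<close>
    to vanish.\<close>
  moreover from this have "D'_det N lam b (Suc k) \<noteq> 0"
    using A_det_pos[of "Suc k"] k by auto
  ultimately show ?thesis
    by (simp add: h_def field_simps)
qed

end

section \<open>Passage from complex to real polynomials\<close>

lemma map_poly_of_real_add:
  "map_poly complex_of_real (p + q) = map_poly of_real p + map_poly of_real q"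
  by (rule poly_eqI) (simp add: coeff_map_poly)

lemma map_poly_of_real_smult:
  "map_poly complex_of_real (smult c p) = smult (of_real c) (map_poly of_real p)"
  by (rule poly_eqI) (simp add: coeff_map_poly)

lemma poly_map_poly_of_real:
  "poly (map_poly complex_of_real p) (of_real z) = of_real (poly p z)"
  by (induction p) (simp_all add: map_poly_pCons)

lemma mat_of_rows_list_3_mult_vec:
  "mat_of_rows_list 3 [[a11, a12, a13], [a21, a22, a23], [a31, a32, a33]] *\<^sub>v vec_of_list [v1, v2, v3] =
     vec_of_list [a11 * v1 + a12 * v2 + a13 * v3, a21 * v1 + a22 * v2 + a23 * v3,
       a31 * v1 + a32 * v2 + a33 * (v3 :: 'a :: comm_ring_1)]"
  by (rule eq_vecI)
    (auto simp: mat_of_rows_list_def scalar_prod_def numeral_3_eq_3 less_Suc_eq algebra_simps)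

lemma phi_vec_eq_fund:
  fixes m x :: "nat \<Rightarrow> real"
  defines "\<mu> \<equiv> \<lambda>j. m (Suc j)" and "\<nu> \<equiv> \<lambda>j. x (j + 2) - x (j + 1)"
  shows "phi_vec m x (Suc j) = vec_of_list
    [map_poly of_real (fund_C \<mu> \<nu> j), map_poly of_real (fund_B \<mu> \<nu> j), map_poly of_real (fund_A \<mu> \<nu> j)]"
proof (induction j)
  case 0
  show ?case
    unfolding phi_vec.simps G_mat_def mat_of_rows_list_3_mult_vec
    by (simp add: \<mu>_def map_poly_pCons)
next
  case (Suc j)
  have l: "x (Suc (Suc j)) - x (Suc j) = \<nu> j" and m: "m (Suc (Suc j)) = \<mu> (Suc j)"
    by (simp_all add: \<nu>_def \<mu>_def)
  show ?case
    unfolding phi_vec.simps Suc.IH L_mat_def G_mat_def mat_of_rows_list_3_mult_vec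
    by (simp add: l m map_poly_of_real_add map_poly_of_real_smult map_poly_pCons
        del: smult_minus_left)
qed

section \<open>The inverse problem\<close>

text \<open>Separate from the theorem so that it also applies to a second string with the same
  spectral data.\<close>

lemma determinantal_formulas:
  fixes n :: nat and m x lam b :: "nat \<Rightarrow> real" and M :: real
  assumes n: "n \<ge> 1" and string: "discrete_string n m x" and spec: "spectral_data n m x lam b M"
  shows "\<And>k. k \<le> n - 1 \<Longrightarrow> m (n - k) =
      (D_det (n-1) lam b k)\<^sup>2 / (2 * A_det (n-1) lam b M (k+1) * A_det (n-1) lam b M k)"
    and "\<And>k. k \<in> {1..n-1} \<Longrightarrow> x (n - k + 1) - x (n - k) =
      - (2 * A_det (n-1) lam b M k / D'_det (n-1) lam b k)"
proof -
  define N where "N = n - 1"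
  have nN: "n = Suc N" using n by (simp add: N_def)
  define \<mu> where "\<mu> = (\<lambda>j. m (Suc j))"
  define \<nu> where "\<nu> = (\<lambda>j. x (j + 2) - x (j + 1))"
  note vec = phi_vec_eq_fund[of m x N, folded nN \<mu>_def \<nu>_def]
  have A: "A_poly n m x = map_poly of_real (fund_A \<mu> \<nu> N)"
    and B: "B_poly n m x = map_poly of_real (fund_B \<mu> \<nu> N)"
    unfolding A_poly_def B_poly_def vec by (simp_all add: numeral_2_eq_2)
  have poly_A: "poly (A_poly n m x) (of_real z) = of_real (poly (fund_A \<mu> \<nu> N) z)" for z
    unfolding A by (rule poly_map_poly_of_real)
  have poly_B: "poly (B_poly n m x) (of_real z) = of_real (poly (fund_B \<mu> \<nu> N) z)" for z
    unfolding B by (rule poly_map_poly_of_real)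
  interpret spectral_string N \<mu> \<nu> lam b
  proof
    fix j assume "j \<le> N"
    then show "\<mu> j > 0"
      using string by (auto simp: discrete_string_def \<mu>_def nN)
  next
    fix j assume "j < N"
    then show "\<nu> j > 0"
      using string strict_mono_onD[of "{1..n}" x "j + 1" "j + 2"]
      by (auto simp: discrete_string_def \<nu>_def nN)
  next
    show "inj_on lam {1..N}"
      using spec by (auto simp: spectral_data_def nN intro: strict_mono_on_imp_inj_on)
  next
    fix p assume p: "p \<in> {1..N}"
    then show "lam p > 0"
      using spec by (auto simp: spectral_data_def nN)
    have "of_real (lam p) \<in> {z. poly (A_poly n m x) z = 0}"
      using spec p by (auto simp: spectral_data_def nN)
    then show "poly (fund_A \<mu> \<nu> N) (lam p) = 0"
      by (simp add: poly_A)
  next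
    fix z assume z: "poly (fund_A \<mu> \<nu> N) z \<noteq> 0"
    then have "poly (A_poly n m x) (of_real z) \<noteq> 0"
      by (simp add: poly_A)
    then have "poly (B_poly n m x) (of_real z) / poly (A_poly n m x) (of_real z) =
          (\<Sum>k=1..n-1. of_real (b k) / (of_real z - of_real (lam k)))"
      using spec unfolding spectral_data_def by blast
    then have "complex_of_real (poly (fund_B \<mu> \<nu> N) z / poly (fund_A \<mu> \<nu> N) z) =
        of_real (\<Sum>p=1..N. b p / (z - lam p))"
      unfolding poly_A poly_B by (simp add: nN)
    then show "poly (fund_B \<mu> \<nu> N) z / poly (fund_A \<mu> \<nu> N) z = (\<Sum>p=1..N. b p / (z - lam p))"
      by (simp only: of_real_eq_iff)
  qed
  have mass: "total_mass = M"
    using spec unfolding total_mass_def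
    by (simp add: spectral_data_def nN \<mu>_def sum.atLeast1_atMost_eq lessThan_Suc_atMost[symmetric])
  show "m (n - k) =
      (D_det (n-1) lam b k)\<^sup>2 / (2 * A_det (n-1) lam b M (k+1) * A_det (n-1) lam b M k)"
    if "k \<le> n - 1" for k
    using mass_formula[of k] that unfolding mass by (simp add: \<mu>_def nN Suc_diff_le)
  show "x (n - k + 1) - x (n - k) = - (2 * A_det (n-1) lam b M k / D'_det (n-1) lam b k)"
    if k: "k \<in> {1..n-1}" for k
  proof -
    obtain j where j: "k = Suc j" "Suc j \<le> N"
      using k nN by (cases k) auto
    then have "N - j = Suc (N - Suc j)" by simp
    then show ?thesis
      using length_formula[OF j(2)] j unfolding mass by (simp add: \<nu>_def nN)
  qed
qed

text \<open>Positions enter only through differences, so the translation cancels.\<close>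

lemma phi_vec_cong:
  assumes "\<And>i. i \<in> {1..k} \<Longrightarrow> m' i = m i" "\<And>i. i \<in> {1..k} \<Longrightarrow> x' i = x i + c"
  shows "phi_vec m' x' k = phi_vec m x k"
  using assms
proof (induction m x k rule: phi_vec.induct)
  case (3 m x k)
  have "phi_vec m' x' (Suc k) = phi_vec m x (Suc k)"
    using "3.prems" by (intro "3.IH") auto
  moreover have "m' (k + 2) = m (k + 2)" "x' (k + 2) - x' (k + 1) = x (k + 2) - x (k + 1)"
    using "3.prems"(1)[of "k + 2"] "3.prems"(2)[of "k + 2"] "3.prems"(2)[of "k + 1"] by auto
  ultimately show ?case
    by (simp only: phi_vec.simps)
qed auto

theorem theorem4p19:
  fixes n :: nat and m x lam b :: "nat \<Rightarrow> real" and M :: real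
  assumes "n \<ge> 1"
    and "discrete_string n m x"
    and "spectral_data n m x lam b M"
    and "strict_mono_on {1..n-1} lam"
    and "\<forall>k\<in>{1..n-1}. 0 < lam k"
    and "\<forall>k\<in>{1..n-1}. b k < 0"
    and "M > 0"
  shows "(\<forall>k\<in>{0..n-1}. m (n - k) =
            (D_det (n-1) lam b k)\<^sup>2 / (2 * A_det (n-1) lam b M (k+1) * A_det (n-1) lam b M k))
       \<and> (\<forall>k\<in>{1..n-1}. x (n - k + 1) - x (n - k) =
            - (2 * A_det (n-1) lam b M k / D'_det (n-1) lam b k))
       \<and> (\<forall>m' x'. (discrete_string n m' x' \<and> spectral_data n m' x' lam b M)
            \<longleftrightarrow> (\<exists>c. \<forall>k\<in>{1..n}. m' k = m k \<and> x' k = x k + c))"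
proof (intro conjI allI iffI)
  note rec = determinantal_formulas[OF assms(1-3)]
  show "\<forall>k\<in>{0..n-1}. m (n - k) =
            (D_det (n-1) lam b k)\<^sup>2 / (2 * A_det (n-1) lam b M (k+1) * A_det (n-1) lam b M k)"
    using rec(1) by simp
  show "\<forall>k\<in>{1..n-1}. x (n - k + 1) - x (n - k) =
            - (2 * A_det (n-1) lam b M k / D'_det (n-1) lam b k)"
    using rec(2) by blast
  fix m' x'
  {
    assume "discrete_string n m' x' \<and> spectral_data n m' x' lam b M"
    then have string': "discrete_string n m' x'" and spec': "spectral_data n m' x' lam b M" by auto
    \<comment> \<open>Both strings satisfy the formulas with identical right-hand sides.\<close>
    note rec' = determinantal_formulas[OF assms(1) string' spec']
    have m: "m' k = m k" if "k \<in> {1..n}" for k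
      using rec(1)[of "n - k"] rec'(1)[of "n - k"] that by auto
    have x: "x' (Suc k) - x' k = x (Suc k) - x k" if "1 \<le> k" "Suc k \<le> n" for k
      using rec(2)[of "n - k"] rec'(2)[of "n - k"] that by (simp add: Suc_le_eq)
    \<comment> \<open>Equal gaps telescope; the translation is the displacement of the first
      mass.\<close>
    have x_shift: "x' k = x k + (x' 1 - x 1)" if "1 \<le> k" "k \<le> n" for k
      using that
    proof (induction k rule: dec_induct)
      case (step k)
      then show ?case using x[of k] by simp
    qed simp
    show "\<exists>c. \<forall>k\<in>{1..n}. m' k = m k \<and> x' k = x k + c"
    proof (intro exI[of _ "x' 1 - x 1"] ballI conjI)
      fix k assume k: "k \<in> {1..n}"
      show "m' k = m k" using k by (rule m)
      show "x' k = x k + (x' 1 - x 1)" using k by (intro x_shift) auto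
    qed
  }
  assume "\<exists>c. \<forall>k\<in>{1..n}. m' k = m k \<and> x' k = x k + c"
  then obtain c where c: "\<And>k. k \<in> {1..n} \<Longrightarrow> m' k = m k" "\<And>k. k \<in> {1..n} \<Longrightarrow> x' k = x k + c"
    by blast
  show "discrete_string n m' x'"
    using assms(2) c by (auto simp: discrete_string_def strict_mono_on_def)
  have "phi_vec m' x' n = phi_vec m x n"
    using c by (rule phi_vec_cong)
  moreover have "(\<Sum>k=1..n. m' k) = (\<Sum>k=1..n. m k)"
    using c(1) by (intro sum.cong) auto
  ultimately show "spectral_data n m' x' lam b M"
    using assms(3) by (simp add: spectral_data_def A_poly_def B_poly_def)
qed

end
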